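(* Let $S$ be a Hausdorff countably compact semitopological semigroup which is algebraically a primitive inverse semigroup, $S=\sum_{i\in\mathscr I}B_{\lambda_i}(G_i)$. Suppose that for every $i\in\mathscr I$ there is $\alpha_i\in\lambda_i$ such that the maximal subgroup $(G_i)_{\alpha_i,\alpha_i}$ (with the subspace topology) satisfies at least one of: (1) it is left precompact; (2) it is a pseudocompact paratopological group; (3) it is left $\omega$-precompact and pseudocompact; (4) the subsemigroup $(G_i)_{\alpha_i,\alpha_i}\cup\{0\}$ is a topological semigroup. Then: (i) every maximal subgroup of $S$ is a closed subset of $S$ and hence is countably compact; (ii) for every $i\in\mathscr I$ the subsemigroup $B_{\lambda_i}(G_i)$ is closed and countably compact in $S$, all subspaces $(G_i)_{\alpha,\beta}$, $\alpha,\beta\in\lambda_i$, are homeomorphic to each other, and all maximal subgroups $(G_i)_{\alpha,\alpha}$ are topologically isomorphic countably compact semitopological groups; (iii) if $\mathscr B$ is a base of the topology of $S$ at the unit $(\alpha_i,e_i,\alpha_i)$ of $(G_i)_{\alpha_i,\alpha_i}$ with $U\subseteq(G_i)_{\alpha_i,\alpha_i}$ for all $U\in\mathscr B$, then for all $\beta_i,\gamma_i\in\lambda_i$ and $x\in G_i$ the family $\{(\beta_i,x,\alpha_i)\cdot U\cdot(\alpha_i,e_i,\gamma_i):U\in\mathscr B\}$ is a base of the topology of $S$ at $(\beta_i,x,\gamma_i)$; (iv) the family of all sets $S\setminus\big((G_{i_1})_{\alpha_1,\beta_1}\cup\dots\cup(G_{i_k})_{\alpha_k,\beta_k}\big)$,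 where $k\in\mathbb N$, $i_1,\dots,i_k\in\mathscr I$ and $\alpha_j,\beta_j\in\lambda_{i_j}$, is a base of the topology of $S$ at zero.
   Context: All spaces are Hausdorff; a semitopological (topological) semigroup is a Hausdorff space with a separately (jointly) continuous associative operation; a semitopological group (paratopological group) is a group with Hausdorff topology and separately (jointly) continuous multiplication. For a group $G$ and cardinal $\lambda\ge1$, $B_\lambda(G)=(\lambda\times G\times\lambda)\cup\{0\}$ with $(\alpha,a,\beta)(\gamma,b,\delta)=(\alpha,ab,\delta)$ if $\beta=\gamma$ and $0$ otherwise. The orthogonal sum of semigroups $T_\iota$ with zeros is $\{0\}\cup\bigcup_\iota(T_\iota\setminus\{0_\iota\})$ with products computed in $T_\iota$ when both factors lie in the same $T_\iota$ and the product is non-zero, and $0$ otherwise. Primitive inverse semigroups are exactly orthogonal sums $\sum_{i\in\mathscr I}B_{\lambda_i}(G_i)$; we identify $B_{\lambda_i}(G_i)$ with a subsemigroup of $S$, write $(G_i)_{\alpha,\beta}=\{(\alpha,g,\beta):g\in G_i\}$ and $e_i$ for the unit of $G_i$; the maximal subgroups of $S$ are $\{0\}$ and the sets $(G_i)_{\alpha,\alpha}$. A group with topology is left precompact (left $\omega$-precompact) if for each neighbourhood $U$ of the unit there is a finite (countable) $F$ with $FU=G$. *)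

theory Defs
  imports "HOL-Analysis.Analysis" "HOL-Algebra.Group"
begin

text \<open>Elements of the orthogonal sum of Brandt semigroups B_{lambda_i}(G_i):
  the zero, and triples (alpha, g, beta) tagged with the summand index i.\<close>
datatype ('i, 'l, 'g) psg = PZero | PElem 'i 'l 'g 'l

definition psg_carrier :: "'i set \<Rightarrow> ('i \<Rightarrow> 'l set) \<Rightarrow> ('i \<Rightarrow> 'g monoid) \<Rightarrow> ('i,'l,'g) psg set" where
  "psg_carrier I Lam G = insert PZero
     {PElem i a g b | i a g b. i \<in> I \<and> a \<in> Lam i \<and> b \<in> Lam i \<and> g \<in> carrier (G i)}"

fun psg_mult :: "('i \<Rightarrow> 'g monoid) \<Rightarrow> ('i,'l,'g) psg \<Rightarrow> ('i,'l,'g) psg \<Rightarrow> ('i,'l,'g) psg" where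
  "psg_mult G (PElem i a g b) (PElem j c h d) =
     (if i = j \<and> b = c then PElem i a (g \<otimes>\<^bsub>G i\<^esub> h) d else PZero)"
| "psg_mult G _ _ = PZero"

definition brandt_part :: "('i \<Rightarrow> 'l set) \<Rightarrow> ('i \<Rightarrow> 'g monoid) \<Rightarrow> 'i \<Rightarrow> ('i,'l,'g) psg set" where
  "brandt_part Lam G i = insert PZero
     {PElem i a g b | a g b. a \<in> Lam i \<and> b \<in> Lam i \<and> g \<in> carrier (G i)}"

definition cell :: "('i \<Rightarrow> 'g monoid) \<Rightarrow> 'i \<Rightarrow> 'l \<Rightarrow> 'l \<Rightarrow> ('i,'l,'g) psg set" where
  "cell G i a b = {PElem i a g b | g. g \<in> carrier (G i)}"

definition countably_compact_space :: "'a topology \<Rightarrow> bool" where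
  "countably_compact_space X \<longleftrightarrow>
     (\<forall>\<U>. countable \<U> \<and> (\<forall>U\<in>\<U>. openin X U) \<and> topspace X \<subseteq> \<Union>\<U> \<longrightarrow>
        (\<exists>\<F>. finite \<F> \<and> \<F> \<subseteq> \<U> \<and> topspace X \<subseteq> \<Union>\<F>))"

definition pseudocompact_space :: "'a topology \<Rightarrow> bool" where
  "pseudocompact_space X \<longleftrightarrow>
     (\<forall>\<U>. (\<forall>U\<in>\<U>. openin X U \<and> U \<noteq> {}) \<and> locally_finite_in X \<U> \<longrightarrow> finite \<U>)"

definition set_mult :: "('a \<Rightarrow> 'a \<Rightarrow> 'a) \<Rightarrow> 'a set \<Rightarrow> 'a set \<Rightarrow> 'a set" where
  "set_mult m A B = {m a b | a b. a \<in> A \<and> b \<in> B}"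

text \<open>Left (omega-)precompactness of the group H (with operation m, unit e) in the topology X
  (X is the subspace topology on H).\<close>
definition left_precompact :: "'a topology \<Rightarrow> ('a \<Rightarrow> 'a \<Rightarrow> 'a) \<Rightarrow> 'a \<Rightarrow> bool" where
  "left_precompact X m e \<longleftrightarrow>
     (\<forall>U. openin X U \<and> e \<in> U \<longrightarrow>
        (\<exists>F. finite F \<and> F \<subseteq> topspace X \<and> set_mult m F U = topspace X))"

definition left_omega_precompact :: "'a topology \<Rightarrow> ('a \<Rightarrow> 'a \<Rightarrow> 'a) \<Rightarrow> 'a \<Rightarrow> bool" where
  "left_omega_precompact X m e \<longleftrightarrow>
     (\<forall>U. openin X U \<and> e \<in> U \<longrightarrow>
        (\<exists>F. countable F \<and> F \<subseteq> topspace X \<and> set_mult m F U = topspace X))"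

definition jointly_continuous :: "'a topology \<Rightarrow> ('a \<Rightarrow> 'a \<Rightarrow> 'a) \<Rightarrow> bool" where
  "jointly_continuous X m \<longleftrightarrow>
     continuous_map (prod_topology X X) X (\<lambda>(x, y). m x y)"

definition separately_continuous :: "'a topology \<Rightarrow> ('a \<Rightarrow> 'a \<Rightarrow> 'a) \<Rightarrow> bool" where
  "separately_continuous X m \<longleftrightarrow>
     (\<forall>a\<in>topspace X. continuous_map X X (\<lambda>x. m a x) \<and> continuous_map X X (\<lambda>x. m x a))"

definition base_at :: "'a topology \<Rightarrow> 'a \<Rightarrow> 'a set set \<Rightarrow> bool" where
  "base_at X x \<B> \<longleftrightarrow>
     (\<forall>U\<in>\<B>. openin X U \<and> x \<in> U) \<and>
     (\<forall>W. openin X W \<and> x \<in> W \<longrightarrow> (\<exists>U\<in>\<B>. U \<subseteq> W))"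

end

theory Submission
  imports Defs
begin

text \<open>The maps \<open>x \<mapsto> e x f\<close> for nonzero idempotents \<open>e, f\<close> show that all sets \<open>(G i)\<^bsub>\<alpha>,\<beta>\<^esub>\<close> are open
  and that translations identify them with one another, zero being fixed. Everything therefore reduces
  to zero being isolated in \<open>H \<union> {0}\<close>, where \<open>H\<close> is the distinguished maximal subgroup: then all
  \<open>(G i)\<^bsub>\<alpha>,\<beta>\<^esub>\<close> are clopen, and countable compactness lets only finitely many of them leave a given
  neighbourhood of zero. Isolation is clear if finitely many translates of a set \<open>C\<close> with \<open>0\<close>
  outside its closure cover \<open>H\<close>, since the corresponding translates of a neighbourhood of zero missing
  \<open>C\<close> intersect in \<open>{0}\<close>. In case (1) \<open>C\<close> is a neighbourhood of the unit, in case (2) the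
  closure of one. In case (3) countably many translates give a decreasing locally
  finite sequence of open sets in \<open>H\<close>, and case (4) is a direct argument with sequences.\<close>

section \<open>Countably compact and feebly compact spaces\<close>

text \<open>Turns the failure of a finite covering into a sequence: each term is chosen against the
  finite set of all earlier terms.\<close>

lemma ex_sequence_from_finite_extension:
  assumes "\<And>F. finite F \<Longrightarrow> F \<subseteq> C \<Longrightarrow> \<exists>x\<in>C. \<forall>f\<in>F. P f x"
  shows "\<exists>x :: nat \<Rightarrow> 'a. (\<forall>n. x n \<in> C) \<and> (\<forall>k n. k < n \<longrightarrow> P (x k) (x n))"
proof -
  have "\<exists>x. \<forall>n::nat. x n \<in> C \<and> (\<forall>k<n. P (x k) (x n))"
  proof (rule dependent_wellorder_choice)
    fix n :: nat and x :: "nat \<Rightarrow> 'a"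
    assume "\<And>m. m < n \<Longrightarrow> x m \<in> C \<and> (\<forall>k<m. P (x k) (x m))"
    then have "x ` {..<n} \<subseteq> C" by auto
    then show "\<exists>r. r \<in> C \<and> (\<forall>k<n. P (x k) r)"
      using assms[of "x ` {..<n}"] by auto
  qed auto
  then show ?thesis by blast
qed

lemma infinite_nat_greater:
  assumes "infinite {n::nat. P n}"
  obtains m where "n < m" "P m"
  using assms unfolding infinite_nat_iff_unbounded by auto

lemma infinite_nat_two:
  assumes "infinite {n::nat. P n}"
  obtains k m where "k < m" "P k" "P m"
  using infinite_nat_greater[OF assms] by metis

lemma countably_compact_space_closed_subtopology:
  assumes "countably_compact_space X" "closedin X C"
  shows "countably_compact_space (subtopology X C)"
  unfolding countably_compact_space_def
proof (intro allI impI, elim conjE)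
  fix \<U>
  assume c: "countable \<U>" and o: "\<forall>U\<in>\<U>. openin (subtopology X C) U"
    and cov: "topspace (subtopology X C) \<subseteq> \<Union>\<U>"
  have "\<forall>U\<in>\<U>. \<exists>V. openin X V \<and> U = V \<inter> C"
    using o by (simp add: openin_subtopology)
  then obtain V where V: "\<And>U. U \<in> \<U> \<Longrightarrow> openin X (V U) \<and> U = V U \<inter> C"
    by metis
  have CX: "C \<subseteq> topspace X" using assms(2) closedin_subset by blast
  let ?\<V> = "insert (topspace X - C) (V ` \<U>)"
  have "countable ?\<V>" using c by simp
  moreover have "\<forall>U\<in>?\<V>. openin X U" using V assms(2) by auto
  moreover have "topspace X \<subseteq> \<Union>?\<V>"
  proof
    fix x assume x: "x \<in> topspace X"
    show "x \<in> \<Union>?\<V>"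
    proof (cases "x \<in> C")
      case True
      then obtain U where "U \<in> \<U>" "x \<in> U" using cov x by auto
      then show ?thesis using V by blast
    qed (use x in blast)
  qed
  ultimately obtain \<F> where \<F>: "finite \<F>" "\<F> \<subseteq> ?\<V>" "topspace X \<subseteq> \<Union>\<F>"
    using assms(1) unfolding countably_compact_space_def by meson
  have "\<F> - {topspace X - C} \<subseteq> V ` \<U>" using \<F>(2) by auto
  then obtain \<G> where \<G>: "\<G> \<subseteq> \<U>" "finite \<G>" "\<F> - {topspace X - C} = V ` \<G>"
    using finite_subset_image[of "\<F> - {topspace X - C}" V \<U>] \<F>(1) by auto
  have "topspace (subtopology X C) \<subseteq> \<Union>\<G>"
  proof
    fix x assume "x \<in> topspace (subtopology X C)"
    then have x: "x \<in> C" "x \<in> topspace X" by auto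
    then obtain A where "A \<in> \<F>" "x \<in> A" using \<F>(3) by auto
    then have "A \<in> V ` \<G>" using x \<G>(3) by blast
    then obtain U where "U \<in> \<G>" "x \<in> V U" using \<open>x \<in> A\<close> by auto
    then show "x \<in> \<Union>\<G>" using V \<G>(1) x by blast
  qed
  then show "\<exists>\<F>. finite \<F> \<and> \<F> \<subseteq> \<U> \<and> topspace (subtopology X C) \<subseteq> \<Union>\<F>"
    using \<G> by blast
qed

lemma countably_compact_accumulation:
  fixes x :: "nat \<Rightarrow> 'a"
  assumes "countably_compact_space X" "range x \<subseteq> topspace X" "infinite M"
  obtains p where "p \<in> topspace X"
    "\<And>N. openin X N \<Longrightarrow> p \<in> N \<Longrightarrow> infinite {n\<in>M. x n \<in> N}"
proof (rule ccontr)
  assume "\<not> thesis"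
  then have fin: "\<And>p. p \<in> topspace X \<Longrightarrow> \<exists>N. openin X N \<and> p \<in> N \<and> finite {n\<in>M. x n \<in> N}"
    using that by blast
  \<comment> \<open>If there is no accumulation point, these countably many open sets cover
    \<open>X\<close>, and a finite subcover bounds the indices in \<open>M\<close>. Indices are
    counted, not values, so repeated terms do no harm and subsequences need no reindexing.\<close>
  define U where "U k = \<Union>{N. openin X N \<and> (\<forall>n\<in>M. x n \<in> N \<longrightarrow> n < k)}" for k
  have "openin X (U k)" for k unfolding U_def by blast
  moreover have "topspace X \<subseteq> \<Union>(range U)"
  proof
    fix p assume "p \<in> topspace X"
    then obtain N where N: "openin X N" "p \<in> N" "finite {n\<in>M. x n \<in> N}" using fin by blast
    then obtain k where "\<forall>n\<in>{n\<in>M. x n \<in> N}. n < k" using finite_nat_set_iff_bounded by blast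
    then have "p \<in> U k" using N unfolding U_def by blast
    then show "p \<in> \<Union>(range U)" by blast
  qed
  ultimately have "countable (range U) \<and> (\<forall>N\<in>range U. openin X N) \<and> topspace X \<subseteq> \<Union>(range U)"
    by blast
  then obtain \<F> where "finite \<F>" "\<F> \<subseteq> range U" "topspace X \<subseteq> \<Union>\<F>"
    using assms(1) unfolding countably_compact_space_def by meson
  then obtain K where K: "finite K" "topspace X \<subseteq> \<Union>(U ` K)"
    using finite_subset_image by metis
  have "M \<subseteq> (\<Union>k\<in>K. {..<k})"
  proof
    fix n assume "n \<in> M"
    moreover have "x n \<in> topspace X" using assms(2) by auto
    ultimately obtain k where "k \<in> K" "x n \<in> U k" using K(2) by blast
    then have "n < k" using \<open>n \<in> M\<close> unfolding U_def by blast
    then show "n \<in> (\<Union>k\<in>K. {..<k})" using \<open>k \<in> K\<close> by blast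
  qed
  moreover have "finite (\<Union>k\<in>K. {..<k})" using K(1) by blast
  ultimately show False using assms(3) finite_subset by blast
qed

lemma pseudocompact_accumulation:
  fixes A :: "nat \<Rightarrow> 'a set"
  assumes pc: "pseudocompact_space X" and op: "\<And>n. openin X (A n)" and ne: "\<And>n. A n \<noteq> {}"
  obtains y where "y \<in> topspace X"
    "\<And>N. openin X N \<Longrightarrow> y \<in> N \<Longrightarrow> infinite {n. N \<inter> A n \<noteq> {}}"
proof (rule ccontr)
  assume "\<not> thesis"
  then have fin: "\<And>y. y \<in> topspace X \<Longrightarrow> \<exists>N. openin X N \<and> y \<in> N \<and> finite {n. N \<inter> A n \<noteq> {}}"
    using that by blast
  have "locally_finite_in X (range A)"
    unfolding locally_finite_in_def
  proof (intro conjI ballI)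
    show "\<Union>(range A) \<subseteq> topspace X" using op openin_subset by blast
    fix y assume "y \<in> topspace X"
    then obtain N where N: "openin X N" "y \<in> N" "finite {n. N \<inter> A n \<noteq> {}}" using fin by blast
    have "{U \<in> range A. U \<inter> N \<noteq> {}} \<subseteq> A ` {n. N \<inter> A n \<noteq> {}}" by blast
    then show "\<exists>V. openin X V \<and> y \<in> V \<and> finite {U \<in> range A. U \<inter> V \<noteq> {}}"
      using N finite_surj by meson
  qed
  moreover have "\<forall>U\<in>range A. openin X U \<and> U \<noteq> {}" using op ne by auto
  ultimately have "finite (range A)"
    using pc unfolding pseudocompact_space_def by meson
  \<comment> \<open>Local finiteness concerns the set \<open>range A\<close>, where repetitions are
    lost. Once this set is finite, some member recurs at infinitely many indices, and each of its
    points is an accumulation point.\<close>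
  then obtain n0 where n0: "infinite {n. A n = A n0}"
    using pigeonhole_infinite[of UNIV A] by auto
  obtain y where y: "y \<in> A n0" using ne by blast
  then obtain N where N: "y \<in> N" "finite {n. N \<inter> A n \<noteq> {}}"
    using fin op openin_subset by (metis subsetD)
  have "{n. A n = A n0} \<subseteq> {n. N \<inter> A n \<noteq> {}}" using y N(1) by blast
  then show False using n0 N(2) finite_subset by blast
qed

lemma jointly_continuous_nbhds:
  assumes "jointly_continuous X m" "openin X N" "x \<in> topspace X" "y \<in> topspace X" "m x y \<in> N"
  obtains A B where "openin X A" "openin X B" "x \<in> A" "y \<in> B"
    "\<And>a b. a \<in> A \<Longrightarrow> b \<in> B \<Longrightarrow> m a b \<in> N"
proof -
  let ?P = "{p \<in> topspace (prod_topology X X). (case p of (a, b) \<Rightarrow> m a b) \<in> N}"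
  have "openin (prod_topology X X) ?P"
    using assms(1,2) unfolding jointly_continuous_def by (rule openin_continuous_map_preimage)
  moreover have "(x, y) \<in> ?P" using assms by simp
  ultimately obtain A B where AB: "openin X A" "openin X B" "x \<in> A" "y \<in> B" "A \<times> B \<subseteq> ?P"
    unfolding openin_prod_topology_alt by meson
  have "m a b \<in> N" if "a \<in> A" "b \<in> B" for a b using AB(5) that by auto
  then show thesis using that AB by blast
qed

section \<open>Feebly compact paratopological groups\<close>

locale semitopological_group = group G for G (structure) +
  fixes X :: "'a topology"
  assumes topspace_eq: "topspace X = carrier G"
    and continuous_l: "\<And>a. a \<in> carrier G \<Longrightarrow> continuous_map X X (\<lambda>x. a \<otimes> x)"
    and continuous_r: "\<And>a. a \<in> carrier G \<Longrightarrow> continuous_map X X (\<lambda>x. x \<otimes> a)"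
begin

lemma openin_carrier: "openin X U \<Longrightarrow> u \<in> U \<Longrightarrow> u \<in> carrier G"
  using openin_subset[of X U] topspace_eq by blast

lemma openin_l_preimage:
  "openin X U \<Longrightarrow> a \<in> carrier G \<Longrightarrow> openin X {x \<in> carrier G. a \<otimes> x \<in> U}"
  using openin_continuous_map_preimage[OF continuous_l] topspace_eq by fastforce

lemma openin_r_preimage:
  "openin X U \<Longrightarrow> a \<in> carrier G \<Longrightarrow> openin X {x \<in> carrier G. x \<otimes> a \<in> U}"
  using openin_continuous_map_preimage[OF continuous_r] topspace_eq by fastforce

lemma openin_l_image:
  assumes "openin X U" "a \<in> carrier G"
  shows "openin X ((\<lambda>x. a \<otimes> x) ` U)"
proof -
  \<comment> \<open>The image under translation by \<open>a\<close> is the preimage under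
    translation by \<open>inv a\<close>.\<close>
  have "(\<lambda>x. a \<otimes> x) ` U = {x \<in> carrier G. inv a \<otimes> x \<in> U}"
  proof (intro equalityI subsetI)
    fix x assume "x \<in> (\<lambda>x. a \<otimes> x) ` U"
    then show "x \<in> {x \<in> carrier G. inv a \<otimes> x \<in> U}"
      using assms openin_carrier by (auto simp: m_assoc[symmetric])
  next
    fix x assume "x \<in> {x \<in> carrier G. inv a \<otimes> x \<in> U}"
    then have "x = a \<otimes> (inv a \<otimes> x)" "inv a \<otimes> x \<in> U"
      using assms by (auto simp: m_assoc[symmetric])
    then show "x \<in> (\<lambda>x. a \<otimes> x) ` U" by blast
  qed
  then show ?thesis using openin_l_preimage assms by simp
qed

end

text \<open>\<open>pseudocompact_space\<close> is phrased by locally finite families of open sets,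
  that is, as feeble compactness. Inversion may be discontinuous; the aim is a substitute that still
  yields finite covers by translates of the closure of a neighbourhood of the unit.\<close>

locale feebly_compact_paratopological_group = semitopological_group +
  assumes joint: "jointly_continuous X (mult G)"
    and feebly_compact: "pseudocompact_space X"
begin

lemma nbhd_square:
  assumes "openin X U" "\<one> \<in> U"
  obtains W where "openin X W" "\<one> \<in> W" "\<And>x y. x \<in> W \<Longrightarrow> y \<in> W \<Longrightarrow> x \<otimes> y \<in> U"
proof -
  obtain A B where "openin X A" "openin X B" "\<one> \<in> A" "\<one> \<in> B"
    and "\<And>a b. a \<in> A \<Longrightarrow> b \<in> B \<Longrightarrow> a \<otimes> b \<in> U"
    using jointly_continuous_nbhds[OF joint assms(1), of \<one> \<one>] assms(2) topspace_eq by auto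
  then show thesis using that[of "A \<inter> B"] by auto
qed

text \<open>Products have to be estimated between closures because inverses of elements near the
  unit are only known to lie in a closure.\<close>

lemma closure_of_mult:
  assumes "x \<in> X closure_of A" "y \<in> X closure_of B"
    and "\<And>a b. a \<in> A \<Longrightarrow> b \<in> B \<Longrightarrow> a \<otimes> b \<in> C"
  shows "x \<otimes> y \<in> X closure_of C"
  unfolding in_closure_of
proof (intro conjI allI impI)
  have xy: "x \<in> topspace X" "y \<in> topspace X" using assms by (auto simp: in_closure_of)
  then show "x \<otimes> y \<in> topspace X" using topspace_eq by auto
  fix N assume "x \<otimes> y \<in> N \<and> openin X N"
  then obtain P Q where "openin X P" "openin X Q" "x \<in> P" "y \<in> Q"
    and PQ: "\<And>a b. a \<in> P \<Longrightarrow> b \<in> Q \<Longrightarrow> a \<otimes> b \<in> N"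
    using jointly_continuous_nbhds[OF joint _ xy] by metis
  then obtain a b where "a \<in> A" "a \<in> P" "b \<in> B" "b \<in> Q"
    using assms(1,2) unfolding in_closure_of by meson
  then show "\<exists>c. c \<in> C \<and> c \<in> N" using PQ assms(3) by blast
qed

text \<open>The inversion is continuous up to passing to closures. Otherwise one can choose a decreasing
  sequence of open sets \<open>O n\<close> and open \<open>O' n \<subseteq> O n\<close> such that \<open>O' n\<close> misses \<open>O (n + 1) W\<close>; an
  accumulation point \<open>y\<close> of the \<open>O' n\<close> lies in the closure of each \<open>O (n + 1)\<close>, so the neighbourhood
  \<open>y W\<close> of \<open>y\<close> misses all \<open>O' n\<close>.\<close>
lemma inverse_nbhd_closure:
  assumes U: "openin X U" "\<one> \<in> U"
  obtains V where "openin X V" "\<one> \<in> V" "\<And>v. v \<in> V \<Longrightarrow> inv v \<in> X closure_of U"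
proof (rule ccontr)
  assume "\<not> thesis"
  then have noV: "\<And>V. openin X V \<Longrightarrow> \<one> \<in> V \<Longrightarrow> \<exists>v\<in>V. inv v \<notin> X closure_of U"
    using that by blast
  obtain W where W: "openin X W" "\<one> \<in> W" and WW: "\<And>x y. x \<in> W \<Longrightarrow> y \<in> W \<Longrightarrow> x \<otimes> y \<in> U"
    using nbhd_square[OF U] by blast
  have "\<exists>P Q. openin X P \<and> P \<noteq> {} \<and> openin X Q \<and> Q \<noteq> {} \<and> P \<subseteq> A \<and> Q \<subseteq> A \<and>
      (\<forall>q\<in>Q. \<forall>w\<in>W. q \<otimes> w \<notin> P)" if A: "openin X A" "A \<noteq> {}" for A
  proof -
    obtain x where x: "x \<in> A" "x \<in> carrier G" using A openin_carrier by blast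
    \<comment> \<open>Take \<open>v\<close> with \<open>x \<otimes> v\<close> still in
      \<open>A\<close> but \<open>inv v\<close> outside the closure of \<open>U\<close>, and a
      neighbourhood \<open>N\<close> of \<open>inv v\<close> missing \<open>U\<close>. Then x v N is
      a neighbourhood of x, and x v W one of x v; since W W lies in \<open>U\<close>, the set x v W
      W misses x v N.\<close>
    have "\<one> \<in> {v \<in> carrier G. x \<otimes> v \<in> A}" using x by simp
    then obtain v where v: "v \<in> carrier G" "x \<otimes> v \<in> A" "inv v \<notin> X closure_of U"
      using noV[OF openin_l_preimage[OF A(1) x(2)]] by blast
    then obtain N where N: "openin X N" "inv v \<in> N" "\<And>u. u \<in> U \<Longrightarrow> u \<notin> N"
      unfolding in_closure_of topspace_eq by auto
    have xv: "x \<otimes> v \<in> carrier G" using x v by simp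
    let ?P = "(\<lambda>y. x \<otimes> v \<otimes> y) ` N \<inter> A" and ?Q = "(\<lambda>y. x \<otimes> v \<otimes> y) ` W \<inter> A"
    have "x = x \<otimes> v \<otimes> inv v" using x v by (simp add: m_assoc)
    then have "x \<in> ?P" using x N(2) by blast
    moreover have "x \<otimes> v = x \<otimes> v \<otimes> \<one>" using xv by simp
    then have "x \<otimes> v \<in> ?Q" using v(2) W(2) by blast
    moreover have "openin X ?P" "openin X ?Q"
      using openin_l_image[OF _ xv] N(1) W(1) A(1) by auto
    moreover have "q \<otimes> w \<notin> ?P" if "q \<in> ?Q" "w \<in> W" for q w
    proof
      assume "q \<otimes> w \<in> ?P"
      then obtain n where n: "n \<in> N" "q \<otimes> w = x \<otimes> v \<otimes> n" by blast
      obtain w' where w': "w' \<in> W" "q = x \<otimes> v \<otimes> w'" using \<open>q \<in> ?Q\<close> by blast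
      have cs: "n \<in> carrier G" "w \<in> carrier G" "w' \<in> carrier G"
        using n w' \<open>w \<in> W\<close> N W openin_carrier by blast+
      have "x \<otimes> v \<otimes> (w' \<otimes> w) = x \<otimes> v \<otimes> n"
        using n(2) w'(2) cs xv by (simp add: m_assoc)
      then have "w' \<otimes> w = n" using cs xv by simp
      then show False using WW[OF w'(1) \<open>w \<in> W\<close>] N(3) n(1) by blast
    qed
    ultimately show ?thesis by blast
  qed
  then obtain p q where pq: "\<And>A. openin X A \<Longrightarrow> A \<noteq> {} \<Longrightarrow> openin X (p A) \<and> p A \<noteq> {} \<and>
      openin X (q A) \<and> q A \<noteq> {} \<and> p A \<subseteq> A \<and> q A \<subseteq> A \<and> (\<forall>a\<in>q A. \<forall>w\<in>W. a \<otimes> w \<notin> p A)"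
    by metis
  \<comment> \<open>The sets \<open>D n\<close> and \<open>p (D n)\<close> are the
    \<open>O n\<close> and \<open>O' n\<close> described above; the next set
    \<open>D (Suc n)\<close> is \<open>q (D n)\<close>.\<close>
  define D where "D n = (q ^^ n) (carrier G)" for n
  have Dop: "openin X (D n) \<and> D n \<noteq> {}" for n
  proof (induction n)
    case 0
    then show ?case using topspace_eq openin_topspace[of X] by (auto simp: D_def)
  next
    case (Suc n)
    then show ?case using pq[of "D n"] by (auto simp: D_def)
  qed
  have Dq: "D (Suc n) = q (D n)" for n by (simp add: D_def)
  have Dp: "openin X (p (D n))" "p (D n) \<noteq> {}" "p (D n) \<subseteq> D n" "D (Suc n) \<subseteq> D n"
    and DW: "\<And>a w. a \<in> D (Suc n) \<Longrightarrow> w \<in> W \<Longrightarrow> a \<otimes> w \<notin> p (D n)" for n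
    unfolding Dq using pq[of "D n"] Dop[of n] by blast+
  have Ddec: "D m \<subseteq> D n" if "n \<le> m" for n m
    using lift_Suc_antimono_le[of D, OF Dp(4) that] .
  obtain y where y: "y \<in> topspace X"
    and acc: "\<And>N. openin X N \<Longrightarrow> y \<in> N \<Longrightarrow> infinite {n. N \<inter> p (D n) \<noteq> {}}"
  proof (rule pseudocompact_accumulation[OF feebly_compact, of "\<lambda>n. p (D n)"])
  qed (use Dp(1,2) that in blast)+
  have yc: "y \<in> carrier G" using y topspace_eq by simp
  have "openin X ((\<lambda>x. y \<otimes> x) ` W)" using openin_l_image W yc by blast
  moreover have "y \<otimes> \<one> \<in> (\<lambda>x. y \<otimes> x) ` W" using W by blast
  ultimately have "infinite {n. (\<lambda>x. y \<otimes> x) ` W \<inter> p (D n) \<noteq> {}}" using acc yc by simp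
  then obtain n where "(\<lambda>x. y \<otimes> x) ` W \<inter> p (D n) \<noteq> {}"
    by (rule infinite_nat_greater)
  then obtain w where w: "w \<in> W" "y \<otimes> w \<in> p (D n)" by blast
  have wc: "w \<in> carrier G" using w W openin_carrier by blast
  \<comment> \<open>With \<open>w\<close> fixed, right translation by \<open>w\<close> pulls
    \<open>p (D n)\<close> back to a neighbourhood of \<open>y\<close>, which must meet a later
    \<open>p (D m)\<close>. As \<open>m > n\<close>, that set lies in \<open>D (Suc n)\<close>,
    against the choice of \<open>p\<close> and \<open>q\<close>.\<close>
  let ?N = "{x \<in> carrier G. x \<otimes> w \<in> p (D n)}"
  have "openin X ?N" using openin_r_preimage[OF Dp(1) wc] .
  moreover have "y \<in> ?N" using w yc by simp
  ultimately have "infinite {m. ?N \<inter> p (D m) \<noteq> {}}" by (rule acc)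
  then obtain m where m: "m > n" "?N \<inter> p (D m) \<noteq> {}"
    by (rule infinite_nat_greater)
  then obtain a where a: "a \<otimes> w \<in> p (D n)" "a \<in> p (D m)" by blast
  have "a \<in> D (Suc n)" using a(2) m(1) Dp(3)[of m] Ddec[of "Suc n" m] by auto
  then show False using DW w(1) a(1) by blast
qed

text \<open>Otherwise there is a sequence such that \<open>x n\<close> avoids \<open>x k\<close>
  times the closure of \<open>U\<close> for \<open>k < n\<close>. Translates x n V of a small
  \<open>V\<close> accumulate at some \<open>y\<close>, and y V meeting two of them puts the
  quotient of \<open>x k\<close> and \<open>x n\<close> into a product of two sets V V^-1, hence
  into that closure.\<close>

lemma closure_of_nbhd_finite_cover:
  assumes U: "openin X U" "\<one> \<in> U"
  obtains F where "finite F" "F \<subseteq> carrier G"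
    "\<And>x. x \<in> carrier G \<Longrightarrow> \<exists>f\<in>F. \<exists>u\<in>X closure_of U. x = f \<otimes> u"
proof (rule ccontr)
  assume "\<not> thesis"
  then have noF: "\<And>F. finite F \<Longrightarrow> F \<subseteq> carrier G \<Longrightarrow>
      \<exists>x\<in>carrier G. \<forall>f\<in>F. \<forall>u\<in>X closure_of U. x \<noteq> f \<otimes> u"
    using that by meson
  obtain x where "(\<forall>n::nat. x n \<in> carrier G) \<and>
      (\<forall>k n. k < n \<longrightarrow> (\<forall>u\<in>X closure_of U. x n \<noteq> x k \<otimes> u))"
    using ex_sequence_from_finite_extension
        [of "carrier G" "\<lambda>f x. \<forall>u\<in>X closure_of U. x \<noteq> f \<otimes> u", OF noF] by (rule exE)
  then have x: "\<And>n. x n \<in> carrier G"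
    and xx: "\<And>k n. k < n \<Longrightarrow> \<forall>u\<in>X closure_of U. x n \<noteq> x k \<otimes> u"
    by simp_all
  \<comment> \<open>Halving twice and applying \<open>inverse_nbhd_closure\<close> to
    \<open>U2\<close> makes quotients of elements of \<open>V\<close> lie in the closure of
    \<open>U1\<close>, so products of two quotients lie in the closure of \<open>U\<close>.\<close>
  obtain U1 where U1: "openin X U1" "\<one> \<in> U1" and U1U: "\<And>x y. x \<in> U1 \<Longrightarrow> y \<in> U1 \<Longrightarrow> x \<otimes> y \<in> U"
    using nbhd_square[OF U] by blast
  obtain U2 where U2: "openin X U2" "\<one> \<in> U2" and U2U: "\<And>x y. x \<in> U2 \<Longrightarrow> y \<in> U2 \<Longrightarrow> x \<otimes> y \<in> U1"
    using nbhd_square[OF U1] by blast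
  obtain V' where V': "openin X V'" "\<one> \<in> V'" "\<And>v. v \<in> V' \<Longrightarrow> inv v \<in> X closure_of U2"
    using inverse_nbhd_closure[OF U2] by blast
  define V where "V = V' \<inter> U2"
  have V: "openin X V" "\<one> \<in> V" unfolding V_def using V' U2 by auto
  have Vc: "v \<in> carrier G" if "v \<in> V" for v using that V openin_carrier by blast
  have VV: "v \<otimes> inv w \<in> X closure_of U1" if "v \<in> V" "w \<in> V" for v w
  proof (rule closure_of_mult[OF _ _ U2U])
    show "v \<in> X closure_of U2" using that closure_of_subset[OF openin_subset[OF U2(1)]]
      unfolding V_def by blast
    show "inv w \<in> X closure_of U2" using that V' unfolding V_def by blast
  qed
  obtain y where y: "y \<in> topspace X"
    and acc: "\<And>N. openin X N \<Longrightarrow> y \<in> N \<Longrightarrow> infinite {n. N \<inter> (\<lambda>v. x n \<otimes> v) ` V \<noteq> {}}"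
  proof (rule pseudocompact_accumulation[OF feebly_compact, of "\<lambda>n. (\<lambda>v. x n \<otimes> v) ` V"])
    show "openin X ((\<lambda>v. x n \<otimes> v) ` V)" "(\<lambda>v. x n \<otimes> v) ` V \<noteq> {}" for n
      using openin_l_image[OF V(1) x] V(2) by auto
  qed (rule that)
  have yc: "y \<in> carrier G" using y topspace_eq by simp
  have "y \<otimes> \<one> \<in> (\<lambda>v. y \<otimes> v) ` V" using V by blast
  then have "infinite {n. (\<lambda>v. y \<otimes> v) ` V \<inter> (\<lambda>v. x n \<otimes> v) ` V \<noteq> {}}"
    using acc[OF openin_l_image[OF V(1) yc]] yc by simp
  then obtain k n where kn: "k < n"
    "(\<lambda>v. y \<otimes> v) ` V \<inter> (\<lambda>v. x k \<otimes> v) ` V \<noteq> {}" "(\<lambda>v. y \<otimes> v) ` V \<inter> (\<lambda>v. x n \<otimes> v) ` V \<noteq> {}"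
    by (rule infinite_nat_two)
  then obtain a b c d where abcd: "a \<in> V" "b \<in> V" "c \<in> V" "d \<in> V"
    "y \<otimes> a = x k \<otimes> b" "y \<otimes> c = x n \<otimes> d" by blast
  have "y = (y \<otimes> a) \<otimes> inv a"
    using abcd(1) yc Vc by (simp add: m_assoc)
  then have "y = x k \<otimes> (b \<otimes> inv a)"
    using abcd(1,2) x Vc unfolding abcd(5) by (simp add: m_assoc)
  moreover have "x n = (x n \<otimes> d) \<otimes> inv d"
    using abcd(4) x Vc by (simp add: m_assoc)
  then have "x n = y \<otimes> (c \<otimes> inv d)"
    using abcd(3,4) yc Vc unfolding abcd(6)[symmetric] by (simp add: m_assoc)
  ultimately have "x n = x k \<otimes> ((b \<otimes> inv a) \<otimes> (c \<otimes> inv d))"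
    using abcd x Vc by (simp add: m_assoc)
  moreover have "(b \<otimes> inv a) \<otimes> (c \<otimes> inv d) \<in> X closure_of U"
    using VV abcd U1U closure_of_mult by meson
  ultimately show False using xx[OF kn(1)] by blast
qed

end

section \<open>Groups with an adjoined zero\<close>

text \<open>Models a maximal subgroup together with the zero of the semigroup. The operation of the
  record \<open>G\<close> is a total function, so it also serves at the point \<open>z\<close>
  outside the carrier.\<close>

locale group_with_zero_space = group G for G (structure) +
  fixes Y :: "'a topology" and z :: 'a
  assumes z_notin: "z \<notin> carrier G"
    and topspace_Y: "topspace Y = insert z (carrier G)"
    and Hausdorff_Y: "Hausdorff_space Y"
    and zero_l: "\<And>a. a \<in> carrier G \<Longrightarrow> a \<otimes> z = z"
    and zero_r: "\<And>a. a \<in> carrier G \<Longrightarrow> z \<otimes> a = z"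
    and zero_zero: "z \<otimes> z = z"
    and continuous_Y_l: "\<And>a. a \<in> carrier G \<Longrightarrow> continuous_map Y Y (\<lambda>x. a \<otimes> x)"
    and continuous_Y_r: "\<And>a. a \<in> carrier G \<Longrightarrow> continuous_map Y Y (\<lambda>x. x \<otimes> a)"
begin

abbreviation X where "X \<equiv> subtopology Y (carrier G)"

lemma openin_Y_carrier: "openin Y (carrier G)"
proof -
  have "closedin Y {z}" using Hausdorff_Y topspace_Y by (simp add: closedin_Hausdorff_sing_eq)
  moreover have "topspace Y - {z} = carrier G" using topspace_Y z_notin by auto
  ultimately show ?thesis by (metis openin_diff openin_topspace)
qed

lemma openin_X_iff: "openin X U \<longleftrightarrow> openin Y U \<and> U \<subseteq> carrier G"
  using openin_Y_carrier by (simp add: openin_open_subtopology)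

lemma topspace_X: "topspace X = carrier G"
  using topspace_Y by auto

sublocale semitopological_group G X
proof
  show "topspace X = carrier G" by (rule topspace_X)
  fix a assume a: "a \<in> carrier G"
  show "continuous_map X X (\<lambda>x. a \<otimes> x)" "continuous_map X X (\<lambda>x. x \<otimes> a)"
    using continuous_Y_l[OF a] continuous_Y_r[OF a] a
    by (auto simp: continuous_map_in_subtopology continuous_map_from_subtopology)
qed

text \<open>The set f V, written as a preimage under translation by \<open>inv f\<close> so that
  continuity makes it open.\<close>

definition translate :: "'a \<Rightarrow> 'a set \<Rightarrow> 'a set" where
  "translate f V = {y \<in> topspace Y. inv f \<otimes> y \<in> V}"

lemma openin_translate: "openin Y V \<Longrightarrow> f \<in> carrier G \<Longrightarrow> openin Y (translate f V)"
  unfolding translate_def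
  using openin_continuous_map_preimage[OF continuous_Y_l] by fastforce

lemma zero_in_translate: "z \<in> V \<Longrightarrow> f \<in> carrier G \<Longrightarrow> z \<in> translate f V"
  unfolding translate_def by (simp add: topspace_Y zero_l)

lemma mult_in_translate_iff:
  "f \<in> carrier G \<Longrightarrow> c \<in> carrier G \<Longrightarrow> f \<otimes> c \<in> translate f V \<longleftrightarrow> c \<in> V"
  unfolding translate_def by (simp add: topspace_Y m_assoc[symmetric])

section \<open>Criteria for zero to be isolated\<close>

lemma separate_one_zero:
  obtains U V where "openin X U" "openin Y V" "\<one> \<in> U" "z \<in> V" "U \<inter> V = {}"
proof -
  have "\<one> \<noteq> z" using z_notin by auto
  then obtain U V where "openin Y U" "openin Y V" "\<one> \<in> U" "z \<in> V" "disjnt U V"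
    using Hausdorff_Y topspace_Y unfolding Hausdorff_space_def by (metis insertCI one_closed)
  then show thesis using that[of "U \<inter> carrier G" V] openin_X_iff openin_Y_carrier
    by (auto simp: disjnt_def)
qed

lemma zero_isolated_if_finite_cover:
  assumes F: "finite F" "F \<subseteq> carrier G" and V: "openin Y V" "z \<in> V"
    and cov: "\<And>x. x \<in> carrier G \<Longrightarrow> \<exists>f\<in>F. \<exists>c\<in>carrier G. c \<notin> V \<and> x = f \<otimes> c"
  shows "openin Y {z}"
proof -
  \<comment> \<open>A group element has the form f c with \<open>c\<close> outside \<open>V\<close>,
    so it is missing from \<open>translate f V\<close>. The factor \<open>topspace Y\<close> keeps
    an empty intersection inside the space.\<close>
  let ?W = "(\<Inter>f\<in>F. translate f V) \<inter> topspace Y"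
  have "openin Y ?W"
    using F openin_translate[OF V(1)] by (intro openin_INT) auto
  moreover have "?W = {z}"
  proof (intro equalityI subsetI)
    fix x assume x: "x \<in> ?W"
    have "x \<notin> carrier G"
    proof
      assume "x \<in> carrier G"
      then obtain f c where fc: "f \<in> F" "c \<in> carrier G" "c \<notin> V" "x = f \<otimes> c" using cov by blast
      then have "f \<otimes> c \<in> translate f V" using x by blast
      then show False using fc F(2) mult_in_translate_iff by blast
    qed
    then show "x \<in> {z}" using x topspace_Y by auto
  next
    fix x assume "x \<in> {z}"
    then show "x \<in> ?W" using zero_in_translate[OF V(2)] F(2) topspace_Y by auto
  qed
  ultimately show ?thesis by simp
qed

lemma zero_isolated_if_left_precompact:
  assumes "left_precompact X (mult G) \<one>"
  shows "openin Y {z}"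
proof -
  obtain U V where UV: "openin X U" "openin Y V" "\<one> \<in> U" "z \<in> V" "U \<inter> V = {}"
    by (rule separate_one_zero)
  then obtain F where F: "finite F" "F \<subseteq> topspace X" "set_mult (mult G) F U = topspace X"
    using assms unfolding left_precompact_def by meson
  have "\<exists>f\<in>F. \<exists>c\<in>carrier G. c \<notin> V \<and> x = f \<otimes> c" if "x \<in> carrier G" for x
  proof -
    have "x \<in> set_mult (mult G) F U" using F(3) that topspace_X by simp
    then obtain f u where "f \<in> F" "u \<in> U" "x = f \<otimes> u" unfolding set_mult_def by blast
    then show ?thesis using UV openin_carrier[OF UV(1)] by blast
  qed
  then show ?thesis using zero_isolated_if_finite_cover F UV topspace_X by auto
qed

lemma zero_isolated_if_paratopological:
  assumes "pseudocompact_space X" "jointly_continuous X (mult G)"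
  shows "openin Y {z}"
proof -
  interpret feebly_compact_paratopological_group G X
    using assms by unfold_locales
  obtain U V where UV: "openin X U" "openin Y V" "\<one> \<in> U" "z \<in> V" "U \<inter> V = {}"
    by (rule separate_one_zero)
  obtain F where F: "finite F" "F \<subseteq> carrier G"
    "\<And>x. x \<in> carrier G \<Longrightarrow> \<exists>f\<in>F. \<exists>u\<in>X closure_of U. x = f \<otimes> u"
    using closure_of_nbhd_finite_cover[OF UV(1,3)] by blast
  have "u \<in> carrier G \<and> u \<notin> V" if u: "u \<in> X closure_of U" for u
  proof
    show uc: "u \<in> carrier G" using u topspace_X by (auto simp: in_closure_of)
    \<comment> \<open>An open set that misses \<open>U\<close> also misses the closure of
      \<open>U\<close>.\<close>
    have "openin X (V \<inter> carrier G)" using UV(2) openin_X_iff openin_Y_carrier by auto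
    then show "u \<notin> V" using u uc UV(5) unfolding in_closure_of by blast
  qed
  then show ?thesis using zero_isolated_if_finite_cover[OF F(1,2) UV(2,4)] F(3) by meson
qed

text \<open>If zero is not isolated, the decreasing sets \<open>W n\<close> all meet the group, and
  their traces accumulate at some \<open>y\<close>. Some neighbourhood f k U contains
  \<open>y\<close>, but it is disjoint from \<open>W n\<close> as soon as
  \<open>n \<ge> k\<close>.\<close>

lemma zero_isolated_if_left_omega_precompact:
  assumes "left_omega_precompact X (mult G) \<one>" "pseudocompact_space X"
  shows "openin Y {z}"
proof (rule ccontr)
  assume noniso: "\<not> openin Y {z}"
  obtain U V where UV: "openin X U" "openin Y V" "\<one> \<in> U" "z \<in> V" "U \<inter> V = {}"
    by (rule separate_one_zero)
  then obtain F where F: "countable F" "F \<subseteq> topspace X" "set_mult (mult G) F U = topspace X"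
    using assms(1) unfolding left_omega_precompact_def by meson
  have "F \<noteq> {}" using F(3) topspace_X unfolding set_mult_def by auto
  define f where "f = from_nat_into F"
  have range_f: "range f = F" unfolding f_def using \<open>F \<noteq> {}\<close> F(1) by (rule range_from_nat_into)
  then have fc: "f n \<in> carrier G" for n using F(2) topspace_X by auto
  define W where "W n = (\<Inter>k\<in>{..n}. translate (f k) V) \<inter> topspace Y" for n
  have W: "openin Y (W n)" "z \<in> W n" for n
  proof -
    show "openin Y (W n)"
      unfolding W_def using openin_translate[OF UV(2) fc] by (intro openin_INT) auto
    show "z \<in> W n" unfolding W_def using zero_in_translate[OF UV(4) fc] topspace_Y by auto
  qed
  obtain y where y: "y \<in> topspace X"
    and acc: "\<And>N. openin X N \<Longrightarrow> y \<in> N \<Longrightarrow> infinite {n. N \<inter> (W n \<inter> carrier G) \<noteq> {}}"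
  proof (rule pseudocompact_accumulation[OF assms(2), of "\<lambda>n. W n \<inter> carrier G"])
    fix n
    show "openin X (W n \<inter> carrier G)" using W(1) openin_X_iff openin_Y_carrier by auto
    have "W n \<noteq> {z}" using noniso W(1)[of n] by auto
    then show "W n \<inter> carrier G \<noteq> {}" using W(2)[of n] topspace_Y unfolding W_def by auto
  qed (use that in blast)
  have "y \<in> set_mult (mult G) F U" using F(3) y by simp
  then obtain k u where ku: "u \<in> U" "y = f k \<otimes> u" unfolding set_mult_def range_f[symmetric] by blast
  then have "infinite {n. (\<lambda>x. f k \<otimes> x) ` U \<inter> (W n \<inter> carrier G) \<noteq> {}}"
    using acc[OF openin_l_image[OF UV(1) fc]] by blast
  then obtain n where n: "k < n" "(\<lambda>x. f k \<otimes> x) ` U \<inter> (W n \<inter> carrier G) \<noteq> {}"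
    by (rule infinite_nat_greater)
  then obtain v where v: "v \<in> U" "f k \<otimes> v \<in> W n" by blast
  then have "f k \<otimes> v \<in> translate (f k) V" using n(1) unfolding W_def by auto
  then have "v \<in> V" using mult_in_translate_iff[OF fc openin_carrier[OF UV(1) v(1)]] by simp
  then show False using v(1) UV(5) by blast
qed

text \<open>If zero were not isolated, there would be a sequence such that all \<open>inv (x k) \<otimes> x n\<close>, \<open>k < n\<close>,
  lie in a neighbourhood \<open>V\<close> of zero missing \<open>U\<inverse> U\<close> and \<open>U U\<inverse>\<close>. Then neither \<open>x\<close> nor \<open>inv x\<close> has an
  accumulation point in the group, so both converge to zero, and \<open>x n \<otimes> inv (x n) = \<one>\<close> contradicts
  the continuity of the multiplication at \<open>(z, z)\<close>.\<close>
lemma zero_isolated_if_countably_compact_topological: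
  assumes joint: "jointly_continuous Y (mult G)" and cc: "countably_compact_space Y"
  shows "openin Y {z}"
proof (rule ccontr)
  assume noniso: "\<not> openin Y {z}"
  obtain P Q where PQ: "openin X P" "openin Y Q" "\<one> \<in> P" "z \<in> Q" "P \<inter> Q = {}"
    by (rule separate_one_zero)
  have top: "z \<in> topspace Y" "\<one> \<in> topspace Y" using topspace_Y by auto
  \<comment> \<open>\<open>U1\<close>, \<open>V1\<close> and \<open>V2\<close>, \<open>U2\<close>
    keep \<open>V\<close> away from the quotients of elements of \<open>U\<close> on either side;
    \<open>V3\<close> and \<open>V4\<close> express continuity at \<open>(z, z)\<close>.\<close>
  obtain U1 V1 where 1: "openin Y U1" "openin Y V1" "\<one> \<in> U1" "z \<in> V1"
    "\<And>u v. u \<in> U1 \<Longrightarrow> v \<in> V1 \<Longrightarrow> u \<otimes> v \<in> Q"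
    using jointly_continuous_nbhds[OF joint PQ(2) top(2,1)] zero_l PQ(4) by auto
  obtain V2 U2 where 2: "openin Y V2" "openin Y U2" "z \<in> V2" "\<one> \<in> U2"
    "\<And>v u. v \<in> V2 \<Longrightarrow> u \<in> U2 \<Longrightarrow> v \<otimes> u \<in> Q"
    using jointly_continuous_nbhds[OF joint PQ(2) top] zero_r PQ(4) by auto
  obtain V3 V4 where 3: "openin Y V3" "openin Y V4" "z \<in> V3" "z \<in> V4"
    "\<And>v u. v \<in> V3 \<Longrightarrow> u \<in> V4 \<Longrightarrow> v \<otimes> u \<in> Q"
    using jointly_continuous_nbhds[OF joint PQ(2) top(1,1)] zero_zero PQ(4) by auto
  define U where "U = P \<inter> U1 \<inter> U2"
  define V where "V = V1 \<inter> V2 \<inter> V3 \<inter> V4"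
  have U: "openin X U" "\<one> \<in> U" and V: "openin Y V" "z \<in> V"
    unfolding U_def V_def using PQ 1 2 3 by (auto simp: openin_X_iff)
  have Uc: "u \<in> carrier G" if "u \<in> U" for u using openin_carrier[OF U(1) that] .
  have UiU: "inv u \<otimes> w \<notin> V" if uw: "u \<in> U" "w \<in> U" for u w
  proof
    assume "inv u \<otimes> w \<in> V"
    then have "u \<otimes> (inv u \<otimes> w) \<in> Q" using 1(5) uw unfolding U_def V_def by blast
    then have "w \<in> Q" using Uc uw by (simp add: m_assoc[symmetric])
    then show False using uw PQ(5) unfolding U_def by blast
  qed
  have UUi: "u \<otimes> inv w \<notin> V" if uw: "u \<in> U" "w \<in> U" for u w
  proof
    assume "u \<otimes> inv w \<in> V"
    then have "(u \<otimes> inv w) \<otimes> w \<in> Q" using 2(5) uw unfolding U_def V_def by blast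
    then have "u \<in> Q" using Uc uw by (simp add: m_assoc)
    then show False using uw PQ(5) unfolding U_def by blast
  qed
  \<comment> \<open>If this fails for \<open>F\<close>, the translates by \<open>F\<close> of the
    part of the group outside \<open>V\<close> cover the group, which isolates zero.\<close>
  have ex: "\<exists>x\<in>carrier G. \<forall>f\<in>F. inv f \<otimes> x \<in> V" if F: "finite F" "F \<subseteq> carrier G" for F
  proof (rule ccontr)
    assume "\<not> ?thesis"
    then have neg: "\<forall>x\<in>carrier G. \<exists>f\<in>F. inv f \<otimes> x \<notin> V" by simp
    have "\<exists>f\<in>F. \<exists>c\<in>carrier G. c \<notin> V \<and> x = f \<otimes> c" if xG: "x \<in> carrier G" for x
    proof -
      obtain f where f: "f \<in> F" "inv f \<otimes> x \<notin> V" using neg xG by blast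
      then have "f \<in> carrier G" using F(2) by blast
      then have "x = f \<otimes> (inv f \<otimes> x)" "inv f \<otimes> x \<in> carrier G"
        using that by (simp_all add: m_assoc[symmetric])
      then show ?thesis using f by metis
    qed
    then show False using noniso zero_isolated_if_finite_cover[OF F V] by blast
  qed
  obtain x where "(\<forall>n::nat. x n \<in> carrier G) \<and> (\<forall>k n. k < n \<longrightarrow> inv (x k) \<otimes> x n \<in> V)"
    using ex_sequence_from_finite_extension[of "carrier G" "\<lambda>f x. inv f \<otimes> x \<in> V", OF ex] by (rule exE)
  then have x: "\<And>n. x n \<in> carrier G" and xx: "\<And>k n. k < n \<Longrightarrow> inv (x k) \<otimes> x n \<in> V"
    by simp_all
  have fin1: "finite {n. x n \<notin> V}"
  proof (rule ccontr)
    assume inf: "infinite {n. x n \<notin> V}"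
    obtain p where p: "p \<in> topspace Y"
      and acc: "\<And>N. openin Y N \<Longrightarrow> p \<in> N \<Longrightarrow> infinite {n\<in>{n. x n \<notin> V}. x n \<in> N}"
    proof (rule countably_compact_accumulation[OF cc _ inf])
      show "range x \<subseteq> topspace Y" using x topspace_Y by auto
    qed (use that in blast)
    have "p \<notin> V" using acc[OF V(1)] by auto
    then have pc: "p \<in> carrier G" using p topspace_Y V(2) by auto
    have "p \<otimes> \<one> \<in> (\<lambda>u. p \<otimes> u) ` U" using U(2) by blast
    then have "infinite {n. x n \<notin> V \<and> x n \<in> (\<lambda>u. p \<otimes> u) ` U}"
      using acc[of "(\<lambda>u. p \<otimes> u) ` U"] openin_l_image[OF U(1) pc] openin_X_iff pc by simp
    then obtain k n where kn: "k < n" "x k \<notin> V \<and> x k \<in> (\<lambda>u. p \<otimes> u) ` U"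
      "x n \<notin> V \<and> x n \<in> (\<lambda>u. p \<otimes> u) ` U"
      by (rule infinite_nat_two)
    then obtain u w where uw: "u \<in> U" "w \<in> U" "x k = p \<otimes> u" "x n = p \<otimes> w" by blast
    have "inv (x k) \<otimes> x n = inv u \<otimes> w"
      using uw pc Uc by (simp add: inv_mult_group m_assoc) (simp add: m_assoc[symmetric])
    then show False using xx[OF kn(1)] UiU uw by simp
  qed
  have fin2: "finite {n. inv (x n) \<notin> V}"
  proof (rule ccontr)
    assume inf: "infinite {n. inv (x n) \<notin> V}"
    obtain p where p: "p \<in> topspace Y"
      and acc: "\<And>N. openin Y N \<Longrightarrow> p \<in> N \<Longrightarrow> infinite {n\<in>{n. inv (x n) \<notin> V}. inv (x n) \<in> N}"
    proof (rule countably_compact_accumulation[OF cc _ inf])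
      show "range (\<lambda>n. inv (x n)) \<subseteq> topspace Y" using x topspace_Y by auto
    qed (use that in blast)
    have "p \<notin> V" using acc[OF V(1)] by auto
    then have pc: "p \<in> carrier G" using p topspace_Y V(2) by auto
    \<comment> \<open>This is the set U p. Inverses call for a right translate, because
      \<open>inv (x k) \<otimes> x n\<close> is then a quotient of two elements of \<open>U\<close>
      of the kind excluded by \<open>UUi\<close>.\<close>
    let ?N = "{a \<in> carrier G. a \<otimes> inv p \<in> U}"
    have "openin Y ?N" using openin_r_preimage[OF U(1)] pc openin_X_iff by simp
    moreover have "p \<in> ?N" using U(2) pc by simp
    ultimately have "infinite {n. inv (x n) \<notin> V \<and> inv (x n) \<in> ?N}"
      using acc[of ?N] U(2) by simp
    then obtain k n where kn: "k < n" "inv (x k) \<notin> V \<and> inv (x k) \<in> ?N"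
      "inv (x n) \<notin> V \<and> inv (x n) \<in> ?N"
      by (rule infinite_nat_two)
    have "(inv (x k) \<otimes> inv p) \<otimes> inv (inv (x n) \<otimes> inv p) = inv (x k) \<otimes> x n"
      using x pc by (simp add: inv_mult_group m_assoc) (simp add: m_assoc[symmetric])
    then show False using xx[OF kn(1)] UUi kn by force
  qed
  have "finite ({n. x n \<notin> V} \<union> {n. inv (x n) \<notin> V})" using fin1 fin2 by simp
  then obtain n where "n \<notin> {n. x n \<notin> V} \<union> {n. inv (x n) \<notin> V}"
    using ex_new_if_finite[OF infinite_UNIV_nat] by metis
  then have "x n \<in> V" "inv (x n) \<in> V" by simp_all
  then have "x n \<otimes> inv (x n) \<in> Q" using 3(5) unfolding V_def by blast
  then show False using x PQ(3,5) by auto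
qed

end

section \<open>Primitive inverse semigroups\<close>

text \<open>The map taking x to u x v. For nonzero \<open>u\<close> and \<open>v\<close> in one
  summand it carries a single cell onto a cell and everything else to zero.\<close>

definition sandwich :: "('i \<Rightarrow> 'g monoid) \<Rightarrow> ('i,'l,'g) psg \<Rightarrow> ('i,'l,'g) psg \<Rightarrow> ('i,'l,'g) psg \<Rightarrow> ('i,'l,'g) psg"
  where "sandwich G u v x = psg_mult G (psg_mult G u x) v"

lemma sandwich_PZero [simp]: "sandwich G (PElem i c g a) v PZero = PZero"
  by (simp add: sandwich_def)

lemma sandwich_PElem:
  "sandwich G (PElem i c g a) (PElem i b h d) (PElem j a' y b') =
     (if j = i \<and> a' = a \<and> b' = b then PElem i c (g \<otimes>\<^bsub>G i\<^esub> y \<otimes>\<^bsub>G i\<^esub> h) d else PZero)"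
  by (auto simp: sandwich_def)

lemma PElem_in_cell_iff:
  "PElem i a g b \<in> cell G j c d \<longleftrightarrow> i = j \<and> a = c \<and> b = d \<and> g \<in> carrier (G j)"
  by (auto simp: cell_def)

lemma PZero_notin_cell: "PZero \<notin> cell G j c d"
  by (auto simp: cell_def)

locale primitive_semitopological_semigroup =
  fixes I :: "'i set" and Lam :: "'i \<Rightarrow> 'l set" and G :: "'i \<Rightarrow> 'g monoid"
    and T :: "('i,'l,'g) psg topology"
  assumes groups: "\<And>i. i \<in> I \<Longrightarrow> group (G i)"
    and topspace_T: "topspace T = psg_carrier I Lam G"
    and Hausdorff_T: "Hausdorff_space T"
    and separately: "separately_continuous T (psg_mult G)"
begin

lemma PZero_in_T: "PZero \<in> topspace T"
  by (simp add: topspace_T psg_carrier_def)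

lemma PElem_in_T_iff:
  "PElem i a g b \<in> topspace T \<longleftrightarrow> i \<in> I \<and> a \<in> Lam i \<and> b \<in> Lam i \<and> g \<in> carrier (G i)"
  by (simp add: topspace_T psg_carrier_def)

lemma cell_subset_T: "i \<in> I \<Longrightarrow> a \<in> Lam i \<Longrightarrow> b \<in> Lam i \<Longrightarrow> cell G i a b \<subseteq> topspace T"
  by (auto simp: cell_def PElem_in_T_iff)

lemma continuous_sandwich:
  assumes "u \<in> topspace T" "v \<in> topspace T"
  shows "continuous_map T T (sandwich G u v)"
proof -
  have "continuous_map T T ((\<lambda>x. psg_mult G x v) \<circ> (\<lambda>x. psg_mult G u x))"
    using assms separately unfolding separately_continuous_def by (meson continuous_map_compose)
  then show ?thesis by (simp add: sandwich_def[abs_def] o_def)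
qed

section \<open>Open and closed unions of cells\<close>

lemma openin_T_nonzero: "openin T (topspace T - {PZero})"
  using Hausdorff_T PZero_in_T by (simp add: openin_diff closedin_Hausdorff_sing_eq)

text \<open>For the idempotents e at \<open>a\<close> and f at \<open>b\<close>, the product e x f
  is nonzero exactly when x is in this cell, so the cell is a preimage of the open set of nonzero
  elements.\<close>

lemma openin_cell:
  assumes i: "i \<in> I" and a: "a \<in> Lam i" and b: "b \<in> Lam i"
  shows "openin T (cell G i a b)"
proof -
  interpret group "G i" using groups i by blast
  let ?s = "sandwich G (PElem i a \<one>\<^bsub>G i\<^esub> a) (PElem i b \<one>\<^bsub>G i\<^esub> b)"
  have "openin T {x \<in> topspace T. ?s x \<in> topspace T - {PZero}}"
    by (rule openin_continuous_map_preimage[OF continuous_sandwich openin_T_nonzero])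
      (use assms in \<open>simp_all add: PElem_in_T_iff\<close>)
  moreover have "x \<in> cell G i a b \<longleftrightarrow> x \<in> topspace T \<and> ?s x \<in> topspace T - {PZero}" for x
    by (cases x) (use assms in \<open>auto simp: PZero_notin_cell PElem_in_cell_iff sandwich_PElem PElem_in_T_iff\<close>)
  then have "{x \<in> topspace T. ?s x \<in> topspace T - {PZero}} = cell G i a b" by blast
  ultimately show ?thesis by simp
qed

text \<open>Such a set is a union of cells. Applied to complements, this shows that unions of cells
  with zero adjoined are closed.\<close>

lemma openin_saturated:
  assumes "A \<subseteq> topspace T" "PZero \<notin> A"
    and "\<And>i a g b. PElem i a g b \<in> A \<Longrightarrow> cell G i a b \<subseteq> A"
  shows "openin T A"
proof (subst openin_subopen, intro ballI)
  fix x assume x: "x \<in> A"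
  then obtain i a g b where e: "x = PElem i a g b" using assms(2) by (cases x) auto
  have m: "i \<in> I \<and> a \<in> Lam i \<and> b \<in> Lam i \<and> g \<in> carrier (G i)"
    using x assms(1) PElem_in_T_iff unfolding e by blast
  then have "openin T (cell G i a b)" "x \<in> cell G i a b"
    using openin_cell by (auto simp: PElem_in_cell_iff e)
  moreover have "cell G i a b \<subseteq> A" using assms(3) x unfolding e by simp
  ultimately show "\<exists>S. openin T S \<and> x \<in> S \<and> S \<subseteq> A" by metis
qed

lemma closedin_brandt_part:
  assumes "i \<in> I"
  shows "closedin T (brandt_part Lam G i)"
  unfolding closedin_def
proof
  show "brandt_part Lam G i \<subseteq> topspace T"
    using assms PZero_in_T by (auto simp: brandt_part_def PElem_in_T_iff)
  show "openin T (topspace T - brandt_part Lam G i)"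
    by (rule openin_saturated) (auto simp: brandt_part_def PElem_in_T_iff cell_def)
qed

lemma closedin_insert_PZero_cell:
  assumes "i \<in> I" "a \<in> Lam i" "b \<in> Lam i"
  shows "closedin T (insert PZero (cell G i a b))"
  unfolding closedin_def
proof
  show "insert PZero (cell G i a b) \<subseteq> topspace T"
    using assms PZero_in_T cell_subset_T by blast
  show "openin T (topspace T - insert PZero (cell G i a b))"
    by (rule openin_saturated) (auto simp: PElem_in_T_iff cell_def)
qed

section \<open>Maximal subgroups and translations between cells\<close>

abbreviation cell_group :: "'i \<Rightarrow> 'l \<Rightarrow> ('i,'l,'g) psg monoid" where
  "cell_group i a \<equiv> \<lparr>carrier = cell G i a a, mult = psg_mult G, one = PElem i a \<one>\<^bsub>G i\<^esub> a\<rparr>"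

lemma group_cell_group:
  assumes "i \<in> I"
  shows "group (cell_group i a)"
proof -
  interpret group "G i" using groups assms by blast
  show ?thesis
  proof (rule groupI)
    fix x assume "x \<in> carrier (cell_group i a)"
    then obtain g where g: "g \<in> carrier (G i)" "x = PElem i a g a" by (auto simp: cell_def)
    then have "PElem i a (inv\<^bsub>G i\<^esub> g) a \<in> carrier (cell_group i a)"
      "PElem i a (inv\<^bsub>G i\<^esub> g) a \<otimes>\<^bsub>cell_group i a\<^esub> x = \<one>\<^bsub>cell_group i a\<^esub>"
      by (auto simp: cell_def)
    then show "\<exists>y\<in>carrier (cell_group i a). y \<otimes>\<^bsub>cell_group i a\<^esub> x = \<one>\<^bsub>cell_group i a\<^esub>"
      by blast
  qed (auto simp: cell_def m_assoc)
qed

lemma continuous_cell_translations: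
  assumes "i \<in> I" "a \<in> Lam i" "x \<in> cell G i a a"
  shows "continuous_map T T (\<lambda>y. psg_mult G x y)" "continuous_map T T (\<lambda>y. psg_mult G y x)"
proof -
  have "x \<in> topspace T" using assms cell_subset_T by blast
  then show "continuous_map T T (\<lambda>y. psg_mult G x y)" "continuous_map T T (\<lambda>y. psg_mult G y x)"
    using separately unfolding separately_continuous_def by simp_all
qed

lemma separately_continuous_cell:
  assumes "i \<in> I" "a \<in> Lam i"
  shows "separately_continuous (subtopology T (cell G i a a)) (psg_mult G)"
  unfolding separately_continuous_def
proof
  fix x assume "x \<in> topspace (subtopology T (cell G i a a))"
  then have x: "x \<in> cell G i a a" by simp
  interpret group "G i" using groups assms by blast
  have "psg_mult G x y \<in> cell G i a a" "psg_mult G y x \<in> cell G i a a" if "y \<in> cell G i a a" for y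
    using x that by (auto simp: cell_def)
  then show "continuous_map (subtopology T (cell G i a a)) (subtopology T (cell G i a a)) (psg_mult G x) \<and>
      continuous_map (subtopology T (cell G i a a)) (subtopology T (cell G i a a)) (\<lambda>y. psg_mult G y x)"
    using continuous_cell_translations[OF assms x]
    by (auto simp: continuous_map_in_subtopology continuous_map_from_subtopology)
qed

text \<open>Multiplying by matrix units on both sides changes the two indices and keeps the group
  entry; the units with swapped indices undo this.\<close>

lemma homeomorphic_maps_cells:
  assumes i: "i \<in> I" and l: "a \<in> Lam i" "b \<in> Lam i" "c \<in> Lam i" "d \<in> Lam i"
  shows "homeomorphic_maps (subtopology T (cell G i a b)) (subtopology T (cell G i c d))
    (sandwich G (PElem i c \<one>\<^bsub>G i\<^esub> a) (PElem i b \<one>\<^bsub>G i\<^esub> d))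
    (sandwich G (PElem i a \<one>\<^bsub>G i\<^esub> c) (PElem i d \<one>\<^bsub>G i\<^esub> b))"
proof -
  interpret group "G i" using groups i by blast
  have cont: "continuous_map (subtopology T (cell G i a b)) (subtopology T (cell G i c d))
    (sandwich G (PElem i c \<one>\<^bsub>G i\<^esub> a) (PElem i b \<one>\<^bsub>G i\<^esub> d))"
    if l: "a \<in> Lam i" "b \<in> Lam i" "c \<in> Lam i" "d \<in> Lam i" for a b c d
  proof -
    have "continuous_map T T (sandwich G (PElem i c \<one>\<^bsub>G i\<^esub> a) (PElem i b \<one>\<^bsub>G i\<^esub> d))"
      by (rule continuous_sandwich) (use i l in \<open>simp_all add: PElem_in_T_iff\<close>)
    then show ?thesis
      by (auto simp: continuous_map_in_subtopology continuous_map_from_subtopology cell_def sandwich_PElem)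
  qed
  show ?thesis
    unfolding homeomorphic_maps_def
    using cont[OF l] cont[OF l(3,4,1,2)] by (auto simp: cell_def sandwich_PElem)
qed

lemma homeomorphic_isomorphism_cells:
  assumes i: "i \<in> I" and l: "a \<in> Lam i" "b \<in> Lam i"
  shows "\<exists>f. homeomorphic_map (subtopology T (cell G i a a)) (subtopology T (cell G i b b)) f \<and>
    (\<forall>x\<in>cell G i a a. \<forall>y\<in>cell G i a a. f (psg_mult G x y) = psg_mult G (f x) (f y))"
proof -
  interpret group "G i" using groups i by blast
  let ?f = "sandwich G (PElem i b \<one>\<^bsub>G i\<^esub> a) (PElem i a \<one>\<^bsub>G i\<^esub> b)"
  have "homeomorphic_map (subtopology T (cell G i a a)) (subtopology T (cell G i b b)) ?f"
    using homeomorphic_maps_cells[OF i l(1,1) l(2,2)] by (rule homeomorphic_maps_map[THEN iffD1, THEN conjunct1])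
  \<comment> \<open>In the product of the two images the inner factors (a, 1, b) and (b, 1, a)
    multiply to the unit at \<open>a\<close>.\<close>
  moreover have "\<forall>x\<in>cell G i a a. \<forall>y\<in>cell G i a a. ?f (psg_mult G x y) = psg_mult G (?f x) (?f y)"
    by (auto simp: cell_def sandwich_PElem)
  ultimately show ?thesis by blast
qed

lemma base_at_translate:
  assumes i: "i \<in> I" and a: "a \<in> Lam i" and b: "b \<in> Lam i" and c: "c \<in> Lam i"
    and x: "x \<in> carrier (G i)"
    and \<B>: "base_at T (PElem i a \<one>\<^bsub>G i\<^esub> a) \<B>" and sub: "\<And>U. U \<in> \<B> \<Longrightarrow> U \<subseteq> cell G i a a"
  shows "base_at T (PElem i b x c)
    ((\<lambda>U. (\<lambda>u. psg_mult G (psg_mult G (PElem i b x a) u) (PElem i a \<one>\<^bsub>G i\<^esub> c)) ` U) ` \<B>)"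
proof -
  interpret group "G i" using groups i by blast
  let ?f = "sandwich G (PElem i b x a) (PElem i a \<one>\<^bsub>G i\<^esub> c)"
  \<comment> \<open>\<open>?h\<close> inverts \<open>?f\<close> on the cell containing the members
    of the base, so \<open>?f\<close> applied to such a member \<open>U\<close> gives the preimage
    of \<open>U\<close> under \<open>?h\<close>, which is open.\<close>
  let ?h = "sandwich G (PElem i a (inv\<^bsub>G i\<^esub> x) b) (PElem i c \<one>\<^bsub>G i\<^esub> a)"
  have cf: "continuous_map T T ?f" and ch: "continuous_map T T ?h"
    using i a b c x by (auto intro!: continuous_sandwich simp: PElem_in_T_iff)
  have fe: "?f (PElem i a \<one>\<^bsub>G i\<^esub> a) = PElem i b x c" using x by (simp add: sandwich_PElem)
  have hf: "?h (?f u) = u \<and> ?f u \<in> topspace T" if "u \<in> cell G i a a" for u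
    using that i a b c x
    by (auto simp: cell_def sandwich_PElem PElem_in_T_iff m_assoc[symmetric])
  have fh: "?f (?h y) = y" if "y \<in> topspace T" "?h y \<in> cell G i a a" for y
    using that x
    by (cases y) (auto simp: PZero_notin_cell PElem_in_T_iff sandwich_PElem m_assoc[symmetric] split: if_splits)
  have image: "?f ` U = {y \<in> topspace T. ?h y \<in> U}" if "U \<in> \<B>" for U
  proof (intro equalityI subsetI)
    fix y assume "y \<in> ?f ` U"
    then obtain u where "u \<in> U" "y = ?f u" by (rule imageE)
    then show "y \<in> {y \<in> topspace T. ?h y \<in> U}" using hf[of u] sub[OF that] by auto
  next
    fix y assume y: "y \<in> {y \<in> topspace T. ?h y \<in> U}"
    then have "?f (?h y) = y" using fh[of y] sub[OF that] by auto
    moreover have "?f (?h y) \<in> ?f ` U" using y by (intro imageI) simp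
    ultimately show "y \<in> ?f ` U" by simp
  qed
  have "base_at T (PElem i b x c) ((\<lambda>U. ?f ` U) ` \<B>)"
    unfolding base_at_def
  proof (intro conjI ballI allI impI)
    fix V assume "V \<in> (\<lambda>U. ?f ` U) ` \<B>"
    then obtain U where U: "U \<in> \<B>" "V = ?f ` U" by blast
    then have oU: "openin T U" "PElem i a \<one>\<^bsub>G i\<^esub> a \<in> U" using \<B> by (auto simp: base_at_def)
    show "openin T V" unfolding U(2) image[OF U(1)]
      by (rule openin_continuous_map_preimage[OF ch oU(1)])
    show "PElem i b x c \<in> V" unfolding U(2) using oU(2) fe by (metis imageI)
  next
    fix W assume W: "openin T W \<and> PElem i b x c \<in> W"
    have "openin T {u \<in> topspace T. ?f u \<in> W}"
      using openin_continuous_map_preimage[OF cf] W by blast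
    moreover have "PElem i a \<one>\<^bsub>G i\<^esub> a \<in> {u \<in> topspace T. ?f u \<in> W}"
      using W fe i a by (simp add: PElem_in_T_iff)
    ultimately obtain U where "U \<in> \<B>" "U \<subseteq> {u \<in> topspace T. ?f u \<in> W}"
      using \<B> unfolding base_at_def by meson
    then show "\<exists>V\<in>(\<lambda>U. ?f ` U) ` \<B>. V \<subseteq> W" by blast
  qed
  then show ?thesis by (simp add: sandwich_def)
qed

section \<open>Closed cells and neighbourhoods of zero\<close>

lemma closedin_cell_if_separated:
  assumes i: "i \<in> I" and a: "a \<in> Lam i" and W: "openin T W" "PZero \<in> W" "W \<inter> cell G i a a = {}"
    and b: "b \<in> Lam i" and c: "c \<in> Lam i"
  shows "closedin T (cell G i b c)"
  unfolding closedin_def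
proof
  interpret group "G i" using groups i by blast
  show "cell G i b c \<subseteq> topspace T" using cell_subset_T i b c by blast
  \<comment> \<open>\<open>?s\<close> fixes zero and maps the cell at \<open>b\<close>,
    \<open>c\<close> into the one at \<open>a\<close>, \<open>a\<close>, so it pulls
    \<open>W\<close> back to a neighbourhood of zero missing the former. The rest of the complement
    is a union of cells, hence open.\<close>
  let ?s = "sandwich G (PElem i a \<one>\<^bsub>G i\<^esub> b) (PElem i c \<one>\<^bsub>G i\<^esub> a)"
  let ?W = "{x \<in> topspace T. ?s x \<in> W}"
  have "openin T ?W"
    by (rule openin_continuous_map_preimage[OF continuous_sandwich W(1)])
      (use i a b c in \<open>simp_all add: PElem_in_T_iff\<close>)
  moreover have "topspace T - insert PZero (cell G i b c) \<union> ?W = topspace T - cell G i b c"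
  proof -
    have "?s x \<in> cell G i a a" if "x \<in> cell G i b c" for x
      using that by (auto simp: cell_def sandwich_PElem)
    then show ?thesis using W(2,3) PZero_in_T PZero_notin_cell[of G i b c] by auto
  qed
  moreover have "openin T (topspace T - insert PZero (cell G i b c))"
    using closedin_insert_PZero_cell[OF i b c] unfolding closedin_def by simp
  ultimately show "openin T (topspace T - cell G i b c)"
    using openin_Un[of T "topspace T - insert PZero (cell G i b c)" ?W] by simp
qed

lemma PZero_separated_from_cell:
  assumes cc: "countably_compact_space T" and i: "i \<in> I" and a: "a \<in> Lam i"
    and cond: "let H = cell G i a a; X = subtopology T H; e = PElem i a \<one>\<^bsub>G i\<^esub> a in
         left_precompact X (psg_mult G) e
       \<or> (pseudocompact_space X \<and> jointly_continuous X (psg_mult G))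
       \<or> (left_omega_precompact X (psg_mult G) e \<and> pseudocompact_space X)
       \<or> jointly_continuous (subtopology T (insert PZero H)) (psg_mult G)"
  obtains W where "openin T W" "PZero \<in> W" "W \<inter> cell G i a a = {}"
proof -
  let ?H = "cell G i a a" and ?K = "cell_group i a"
  let ?Y = "subtopology T (insert PZero ?H)"
  interpret K: group ?K using i by (rule group_cell_group)
  interpret group "G i" using groups i by blast
  interpret group_with_zero_space ?K ?Y PZero
  proof
    show "PZero \<notin> carrier ?K" by (simp add: PZero_notin_cell)
    show "topspace ?Y = insert PZero (carrier ?K)"
      using cell_subset_T[OF i a a] PZero_in_T by auto
    show "Hausdorff_space ?Y" using Hausdorff_T by (rule Hausdorff_space_subtopology)
    fix x assume x: "x \<in> carrier ?K"
    then show "x \<otimes>\<^bsub>?K\<^esub> PZero = PZero" "PZero \<otimes>\<^bsub>?K\<^esub> x = PZero" by (auto simp: cell_def)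
    have "psg_mult G x y \<in> insert PZero ?H" "psg_mult G y x \<in> insert PZero ?H"
      if "y \<in> insert PZero ?H" for y
      using x that by (auto simp: cell_def)
    then show "continuous_map ?Y ?Y (\<lambda>y. x \<otimes>\<^bsub>?K\<^esub> y)" "continuous_map ?Y ?Y (\<lambda>y. y \<otimes>\<^bsub>?K\<^esub> x)"
      using continuous_cell_translations[OF i a, of x] x
      by (auto simp: continuous_map_in_subtopology continuous_map_from_subtopology)
  qed simp
  \<comment> \<open>Matches the group topology of the abstract setting with that in
    \<open>cond\<close>, for the first three alternatives. The fourth concerns \<open>?Y\<close>
    itself, which is countably compact as a closed subspace.\<close>
  have X: "subtopology ?Y (carrier ?K) = subtopology T ?H"
    by (simp add: subtopology_subtopology Int_absorb1 subset_insertI)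
  have "countably_compact_space ?Y"
    using countably_compact_space_closed_subtopology[OF cc closedin_insert_PZero_cell[OF i a a]] .
  then have "openin ?Y {PZero}"
    using cond zero_isolated_if_left_precompact zero_isolated_if_paratopological
      zero_isolated_if_left_omega_precompact zero_isolated_if_countably_compact_topological
    unfolding Let_def X by auto
  then obtain W where W: "openin T W \<and> {PZero} = W \<inter> insert PZero ?H"
    unfolding openin_subtopology by (rule exE)
  then have "PZero \<in> W" "W \<inter> ?H \<subseteq> {PZero}" by auto
  moreover have "PZero \<notin> ?H" by (rule PZero_notin_cell)
  ultimately have "PZero \<in> W" "W \<inter> ?H = {}" by auto
  then show thesis using that[of W] W by simp
qed

text \<open>If infinitely many cells left a neighbourhood \<open>W\<close> of zero, points outside
  \<open>W\<close> could be taken from a sequence of distinct cells. They accumulate at a nonzero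
  point, whose open cell would contain infinitely many of them, although distinct cells are
  disjoint.\<close>

lemma base_at_PZero:
  assumes cc: "countably_compact_space T"
    and cl: "\<And>i a b. i \<in> I \<Longrightarrow> a \<in> Lam i \<Longrightarrow> b \<in> Lam i \<Longrightarrow> closedin T (cell G i a b)"
  shows "base_at T PZero {topspace T - \<Union>\<F> | \<F>. finite \<F> \<and>
           \<F> \<subseteq> {cell G i a b | i a b. i \<in> I \<and> a \<in> Lam i \<and> b \<in> Lam i}}"
    (is "base_at T PZero {_ | \<F>. finite \<F> \<and> \<F> \<subseteq> ?C}")
  unfolding base_at_def
proof (intro conjI ballI allI impI)
  fix U assume "U \<in> {topspace T - \<Union>\<F> | \<F>. finite \<F> \<and> \<F> \<subseteq> ?C}"
  then obtain \<F> where F: "finite \<F>" "\<F> \<subseteq> ?C" "U = topspace T - \<Union>\<F>" by blast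
  then have "closedin T (\<Union>\<F>)" using cl by (intro closedin_Union) auto
  then show "openin T U" using F(3) by blast
  show "PZero \<in> U" using F PZero_in_T by (auto simp: cell_def)
next
  fix W assume W: "openin T W \<and> PZero \<in> W"
  let ?F = "{C \<in> ?C. \<not> C \<subseteq> W}"
  have "finite ?F"
  proof (rule ccontr)
    assume "infinite ?F"
    then have "\<exists>f :: nat \<Rightarrow> _. inj f \<and> range f \<subseteq> ?F" by (rule infinite_countable_subset)
    then obtain f :: "nat \<Rightarrow> _" where f: "inj f \<and> range f \<subseteq> ?F" by (rule exE)
    have "f n \<in> ?F" for n using f by (meson rangeI subsetD)
    then have fC: "f n \<in> ?C \<and> \<not> f n \<subseteq> W" for n by (rule CollectD)
    then have "\<forall>n. \<exists>x. x \<in> f n \<and> x \<notin> W" by (meson subsetI)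
    then obtain x where x: "\<And>n. x n \<in> f n \<and> x n \<notin> W" by metis
    have "f n \<subseteq> topspace T" for n using fC[of n] cell_subset_T by blast
    then have rx: "range x \<subseteq> topspace T" using x by blast
    obtain p where p: "p \<in> topspace T"
      and acc: "\<And>N. openin T N \<Longrightarrow> p \<in> N \<Longrightarrow> infinite {n\<in>UNIV. x n \<in> N}"
      by (rule countably_compact_accumulation[OF cc rx infinite_UNIV_nat]) (use that in blast)
    have "p \<notin> W" using acc[of W] W x by auto
    then obtain i a g b where pe: "p = PElem i a g b" using W by (cases p) auto
    have m: "i \<in> I" "a \<in> Lam i" "b \<in> Lam i" "g \<in> carrier (G i)"
      using p PElem_in_T_iff unfolding pe by blast+
    have "infinite {n. x n \<in> cell G i a b}"
      using acc[OF openin_cell[OF m(1-3)]] m(4) by (simp add: pe PElem_in_cell_iff)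
    then obtain k n where kn: "k < n" "x k \<in> cell G i a b" "x n \<in> cell G i a b"
      by (rule infinite_nat_two)
    have eq: "f n = cell G i a b" if "x n \<in> cell G i a b" for n
      using fC[of n] x[of n] that by (auto simp: cell_def)
    have "f k = f n" using eq kn by simp
    then show False using f kn(1) by (metis injD nat_neq_iff)
  qed
  moreover have "topspace T - \<Union>?F \<subseteq> W"
  proof
    fix x assume x: "x \<in> topspace T - \<Union>?F"
    show "x \<in> W"
    proof (cases x)
      case (PElem i a g b)
      then have m: "i \<in> I" "a \<in> Lam i" "b \<in> Lam i" "g \<in> carrier (G i)"
        using x PElem_in_T_iff by blast+
      then have "x \<in> cell G i a b" "cell G i a b \<in> ?C" by (auto simp: PElem PElem_in_cell_iff)
      then show ?thesis using x by blast
    qed (use W in simp)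
  qed
  ultimately show "\<exists>U\<in>{topspace T - \<Union>\<F> | \<F>. finite \<F> \<and> \<F> \<subseteq> ?C}. U \<subseteq> W" by blast
qed

end

theorem theorem2p11:
  fixes I :: "'i set" and Lam :: "'i \<Rightarrow> 'l set" and G :: "'i \<Rightarrow> 'g monoid"
    and T :: "('i,'l,'g) psg topology" and \<alpha> :: "'i \<Rightarrow> 'l"
  assumes groups: "\<forall>i\<in>I. group (G i)"
    and Lam_ne: "\<forall>i\<in>I. Lam i \<noteq> {}"
    and carrier: "topspace T = psg_carrier I Lam G"
    and haus: "Hausdorff_space T"
    and semitop: "separately_continuous T (psg_mult G)"
    and ccompact: "countably_compact_space T"
    and alpha: "\<forall>i\<in>I. \<alpha> i \<in> Lam i \<and>
       (let H = cell G i (\<alpha> i) (\<alpha> i); X = subtopology T H;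
            e = PElem i (\<alpha> i) \<one>\<^bsub>G i\<^esub> (\<alpha> i) in
         left_precompact X (psg_mult G) e
       \<or> (pseudocompact_space X \<and> jointly_continuous X (psg_mult G))
       \<or> (left_omega_precompact X (psg_mult G) e \<and> pseudocompact_space X)
       \<or> jointly_continuous (subtopology T (insert PZero H)) (psg_mult G))"
  shows
    \<comment> \<open>(i)\<close>
    "(closedin T {PZero} \<and> countably_compact_space (subtopology T {PZero}) \<and>
      (\<forall>i\<in>I. \<forall>a\<in>Lam i. closedin T (cell G i a a) \<and>
          countably_compact_space (subtopology T (cell G i a a))))
   \<comment> \<open>(ii)\<close>
   \<and> (\<forall>i\<in>I.
        closedin T (brandt_part Lam G i) \<and>
        countably_compact_space (subtopology T (brandt_part Lam G i)) \<and>
        (\<forall>a\<in>Lam i. \<forall>b\<in>Lam i. \<forall>c\<in>Lam i. \<forall>d\<in>Lam i.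
           subtopology T (cell G i a b) homeomorphic_space subtopology T (cell G i c d)) \<and>
        (\<forall>a\<in>Lam i.
           countably_compact_space (subtopology T (cell G i a a)) \<and>
           separately_continuous (subtopology T (cell G i a a)) (psg_mult G)) \<and>
        (\<forall>a\<in>Lam i. \<forall>b\<in>Lam i. \<exists>f.
           homeomorphic_map (subtopology T (cell G i a a)) (subtopology T (cell G i b b)) f \<and>
           (\<forall>x\<in>cell G i a a. \<forall>y\<in>cell G i a a.
              f (psg_mult G x y) = psg_mult G (f x) (f y))))
   \<comment> \<open>(iii)\<close>
   \<and> (\<forall>i\<in>I. \<forall>\<B>.
        base_at T (PElem i (\<alpha> i) \<one>\<^bsub>G i\<^esub> (\<alpha> i)) \<B> \<and>
        (\<forall>U\<in>\<B>. U \<subseteq> cell G i (\<alpha> i) (\<alpha> i)) \<longrightarrow>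
        (\<forall>b\<in>Lam i. \<forall>c\<in>Lam i. \<forall>x\<in>carrier (G i).
           base_at T (PElem i b x c)
             ((\<lambda>U. (\<lambda>u. psg_mult G (psg_mult G (PElem i b x (\<alpha> i)) u)
                                     (PElem i (\<alpha> i) \<one>\<^bsub>G i\<^esub> c)) ` U) ` \<B>)))
   \<comment> \<open>(iv)\<close>
   \<and> base_at T PZero
        {topspace T - \<Union>\<F> | \<F>. finite \<F> \<and>
           \<F> \<subseteq> {cell G i a b | i a b. i \<in> I \<and> a \<in> Lam i \<and> b \<in> Lam i}}"
proof -
  interpret primitive_semitopological_semigroup I Lam G T
    using groups carrier haus semitop by (simp add: primitive_semitopological_semigroup_def)
  \<comment> \<open>The four alternatives enter through this fact alone: they separate zero from the
    distinguished cell, and translation then makes every cell of the summand closed.\<close>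
  have cl: "closedin T (cell G i b c)" if ibc: "i \<in> I" "b \<in> Lam i" "c \<in> Lam i" for i b c
  proof -
    note a = bspec[OF alpha ibc(1), THEN conjunct1] and cond = bspec[OF alpha ibc(1), THEN conjunct2]
    obtain W where "openin T W" "PZero \<in> W" "W \<inter> cell G i (\<alpha> i) (\<alpha> i) = {}"
      by (rule PZero_separated_from_cell[OF ccompact ibc(1) a cond])
    then show ?thesis using closedin_cell_if_separated ibc a by blast
  qed
  have zero: "closedin T {PZero}"
    using haus PZero_in_T by (simp add: closedin_Hausdorff_sing_eq)
  note cc = countably_compact_space_closed_subtopology[OF ccompact]
  have homeo: "subtopology T (cell G i a b) homeomorphic_space subtopology T (cell G i c d)"
    if "i \<in> I" "a \<in> Lam i" "b \<in> Lam i" "c \<in> Lam i" "d \<in> Lam i" for i a b c d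
    using homeomorphic_maps_cells[OF that] unfolding homeomorphic_space_def by blast
  show ?thesis
  proof (intro conjI ballI allI impI)
    fix i \<B> b c x
    assume ibcx: "i \<in> I" "b \<in> Lam i" "c \<in> Lam i" "x \<in> carrier (G i)"
      and "base_at T (PElem i (\<alpha> i) \<one>\<^bsub>G i\<^esub> (\<alpha> i)) \<B> \<and> (\<forall>U\<in>\<B>. U \<subseteq> cell G i (\<alpha> i) (\<alpha> i))"
    then show "base_at T (PElem i b x c)
       ((\<lambda>U. (\<lambda>u. psg_mult G (psg_mult G (PElem i b x (\<alpha> i)) u)
            (PElem i (\<alpha> i) \<one>\<^bsub>G i\<^esub> c)) ` U) ` \<B>)"
      using base_at_translate[OF ibcx(1) bspec[OF alpha ibcx(1), THEN conjunct1] ibcx(2-4)] by simp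
  next
    show "base_at T PZero {topspace T - \<Union>\<F> | \<F>. finite \<F> \<and>
           \<F> \<subseteq> {cell G i a b | i a b. i \<in> I \<and> a \<in> Lam i \<and> b \<in> Lam i}}"
      using base_at_PZero[OF ccompact cl] .
  qed (assumption | rule zero cl closedin_brandt_part homeo separately_continuous_cell
      homeomorphic_isomorphism_cells cc)+
qed

end
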